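(* Let $d,k\ge 0$ be integers, let $V$ be a real vector space with basis $x_0,\ldots,x_d$, equipped with a symmetric bilinear form $\langle\cdot,\cdot\rangle$ whose Gram matrix $G=(\langle x_i,x_j\rangle)_{0\le i,j\le d}$ is positive definite, and let $\langle\langle\cdot,\cdot\rangle\rangle$ be the induced symmetric bilinear form on $\operatorname{Sym}^kV$ (defined in the context). Then for all multi-indices $\alpha,\beta$ of length $d+1$ with $|\alpha|=|\beta|=k$, $$\langle\langle x^\alpha,x^\beta\rangle\rangle=\frac1c\int_{\mathbb{R}^{d+1}}x^\alpha x^\beta\,d\mu(x),$$ where the measure is $d\mu(x)=\exp\!\Big(-\tfrac12\sum_{i,j}(G^{-1})_{ij}x_ix_j\Big)dx$ and the normalization constant is $c=\int_{\mathbb{R}^{d+1}}d\mu(x)=\sqrt{(2\pi)^{d+1}\det G}$. (In the integral, $x_0,\ldots,x_d$ are the standard coordinates on $\mathbb{R}^{d+1}$.)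
   Context: Multi-indices $\alpha=(\alpha_0,\ldots,\alpha_d)$ have nonnegative integer entries, $|\alpha|=\sum_i\alpha_i$ and $x^\alpha=x_0^{\alpha_0}\cdots x_d^{\alpha_d}$. The symmetric power $\operatorname{Sym}^kV$ is identified with the homogeneous polynomials of degree $k$, $\mathbb{R}[x_0,\ldots,x_d]_k$. The induced form on $\operatorname{Sym}^kV$ is the symmetric bilinear form defined on the basis $\{x_{n_1}\cdots x_{n_k}\mid 0\le n_1\le\ldots\le n_k\le d\}$ by $$\langle\langle x_{n_1}\cdots x_{n_k},\,x_{n_{k+1}}\cdots x_{n_{2k}}\rangle\rangle=\sum_{\mathcal P}\ \prod_{\{i,j\}\in\mathcal P}\langle x_{n_i},x_{n_j}\rangle,$$ where the sum runs over all partitions $\mathcal P$ of $\{1,\ldots,2k\}$ into (unordered) pairs. *)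

theory Defs
  imports "HOL-Analysis.Analysis" "HOL-Library.Poly_Mapping" "HOL-Library.Disjoint_Sets"
begin

text \<open>The indices \<open>0 \<le> \<dots> \<le> d\<close> are the elements of a finite linearly ordered type \<open>'n\<close> with
  \<open>d + 1\<close> elements. Functions \<open>'n \<Rightarrow> nat\<close> are multi-indices.\<close>

definition mi_length :: "('n::finite \<Rightarrow> nat) \<Rightarrow> nat"
  where "mi_length \<alpha> = (\<Sum>i\<in>UNIV. \<alpha> i)"

text \<open>The power \<open>X\<^sup>\<alpha>\<close>, both for indeterminates and for coordinates of a point.\<close>

definition mpower :: "('n::finite \<Rightarrow> 'a::comm_monoid_mult) \<Rightarrow> ('n \<Rightarrow> nat) \<Rightarrow> 'a"
  where "mpower X \<alpha> = (\<Prod>i\<in>UNIV. X i ^ \<alpha> i)"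

text \<open>Polynomials with real coefficients in the indeterminates \<open>'n\<close>; exponents are finitely
  supported functions.\<close>

type_synonym 'n rpoly = "('n \<Rightarrow>\<^sub>0 nat) \<Rightarrow>\<^sub>0 real"

definition Var :: "'n \<Rightarrow> 'n rpoly"
  where "Var i = Poly_Mapping.single (Poly_Mapping.single i 1) 1"

definition exponents :: "nat \<Rightarrow> ('n::finite \<Rightarrow>\<^sub>0 nat) set"
  where "exponents k = {m. mi_length (Poly_Mapping.lookup m) = k}"

text \<open>\<open>Sym\<^sup>k V\<close>, for \<open>V\<close> with a basis indexed by \<open>'n\<close>.\<close>

definition Sym :: "nat \<Rightarrow> 'n::finite rpoly set"
  where "Sym k = {p. Poly_Mapping.keys p \<subseteq> exponents k}"

definition pair_partitions :: "nat set \<Rightarrow> nat set set set"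
  where "pair_partitions S = {P. partition_on S P \<and> (\<forall>p\<in>P. card p = 2)}"

text \<open>Positions in the list are counted from \<open>0\<close>. Since \<open>B\<close> will be symmetric, the factor of a
  pair \<open>{i, j}\<close> does not depend on which of its elements comes first.\<close>

definition pairing_sum :: "('v \<Rightarrow> 'v \<Rightarrow> real) \<Rightarrow> 'v list \<Rightarrow> real"
  where "pairing_sum B vs =
    (\<Sum>P\<in>pair_partitions {..<length vs}. \<Prod>p\<in>P. B (vs ! Min p) (vs ! Max p))"

text \<open>The list \<open>n\<^sub>1 \<le> \<dots> \<le> n\<^sub>k\<close> for which the monomial with exponent \<open>m\<close> is
  \<open>x\<^bsub>n\<^sub>1\<^esub> \<cdots> x\<^bsub>n\<^sub>k\<^esub>\<close>; see the lemma \<open>index_list_exponent\<close> below.\<close>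

definition index_list :: "('n::{finite,linorder} \<Rightarrow>\<^sub>0 nat) \<Rightarrow> 'n list"
  where "index_list m = concat (map (\<lambda>i. replicate (Poly_Mapping.lookup m i) i) (sorted_list_of_set UNIV))"

text \<open>The induced form on \<open>Sym k\<close>: the bilinear extension of its values on the basis of
  monomials. Only the homogeneous parts of degree \<open>k\<close> of the arguments matter.\<close>

definition induced_form ::
  "('v \<Rightarrow> 'v \<Rightarrow> real) \<Rightarrow> ('n::{finite,linorder} \<Rightarrow> 'v) \<Rightarrow> nat \<Rightarrow> 'n rpoly \<Rightarrow> 'n rpoly \<Rightarrow> real"
  where "induced_form B x k p q =
    (\<Sum>m\<in>exponents k. \<Sum>m'\<in>exponents k.
      Poly_Mapping.lookup p m * Poly_Mapping.lookup q m' * pairing_sum B (map x (index_list m @ index_list m')))"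

definition gram :: "('v \<Rightarrow> 'v \<Rightarrow> real) \<Rightarrow> ('n \<Rightarrow> 'v) \<Rightarrow> real ^ 'n ^ 'n"
  where "gram B x = (\<chi> i j. B (x i) (x j))"

definition positive_definite :: "real ^ 'n ^ 'n \<Rightarrow> bool"
  where "positive_definite A \<longleftrightarrow> transpose A = A \<and> (\<forall>v. v \<noteq> 0 \<longrightarrow> 0 < v \<bullet> (A *v v))"

definition gauss_measure :: "real ^ 'n ^ 'n \<Rightarrow> (real ^ 'n) measure"
  where "gauss_measure G = density lborel (\<lambda>y. ennreal
    (exp (- (1/2) * (\<Sum>i\<in>UNIV. \<Sum>j\<in>UNIV. matrix_inv G $ i $ j * y $ i * y $ j))))"

definition gauss_const :: "real ^ 'n ^ 'n \<Rightarrow> real"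
  where "gauss_const G = (\<integral>y. 1 \<partial>gauss_measure G)"


lemma mpower_Var:
  obtains m where "Poly_Mapping.lookup m = \<alpha>" "mpower Var \<alpha> = Poly_Mapping.single m 1"
proof
  let ?m = "\<Sum>i\<in>UNIV. Poly_Mapping.single i (\<alpha> i)"
  have "Var i ^ n = Poly_Mapping.single (Poly_Mapping.single i n) 1" for i :: 'a and n
    by (induction n) (simp_all add: Var_def mult_single flip: single_add)
  moreover have "(\<Prod>i\<in>A. Poly_Mapping.single (f i) (1::real)) = Poly_Mapping.single (\<Sum>i\<in>A. f i) 1"
    if "finite A" for A :: "'a set" and f :: "'a \<Rightarrow> 'a \<Rightarrow>\<^sub>0 nat"
    using that by (induction A) (simp_all add: mult_single)
  ultimately show "mpower Var \<alpha> = Poly_Mapping.single ?m 1"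
    by (simp add: mpower_def)
  show "Poly_Mapping.lookup ?m = \<alpha>"
    by (simp add: fun_eq_iff lookup_sum lookup_single when_def)
qed

lemma mpower_Var_in_Sym:
  assumes "mi_length \<alpha> = k"
  shows "mpower Var \<alpha> \<in> Sym k"
  using assms by (rule_tac mpower_Var[of \<alpha>]) (auto simp: Sym_def exponents_def)

text \<open>The induced form is bilinear, and on the basis of monomials it has the intended values.\<close>

lemma induced_form_add_left:
  "induced_form B x k (p + p') q = induced_form B x k p q + induced_form B x k p' q"
  by (simp add: induced_form_def lookup_add sum.distrib distrib_right)

lemma induced_form_add_right:
  "induced_form B x k p (q + q') = induced_form B x k p q + induced_form B x k p q'"
  by (simp add: induced_form_def lookup_add sum.distrib distrib_left distrib_right)

lemma lookup_const_mult:
  "Poly_Mapping.lookup (Poly_Mapping.single 0 c * p) m = c * Poly_Mapping.lookup (p :: 'n rpoly) m"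
  by (simp flip: mult_map_scale_conv_mult add: Poly_Mapping.map.rep_eq when_def)

lemma induced_form_scale_left:
  "induced_form B x k (Poly_Mapping.single 0 c * p) q = c * induced_form B x k p q"
  unfolding induced_form_def lookup_const_mult by (simp add: sum_distrib_left mult_ac)

lemma induced_form_scale_right:
  "induced_form B x k p (Poly_Mapping.single 0 c * q) = c * induced_form B x k p q"
  unfolding induced_form_def lookup_const_mult by (simp add: sum_distrib_left mult_ac)

lemma finite_exponents: "finite (exponents k :: ('n::finite \<Rightarrow>\<^sub>0 nat) set)"
proof -
  have "Poly_Mapping.lookup ` (exponents k :: ('n \<Rightarrow>\<^sub>0 nat) set) \<subseteq> (UNIV :: 'n set) \<rightarrow>\<^sub>E {..k}"
    by (auto simp: exponents_def mi_length_def intro!: member_le_sum)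
  moreover have "finite ((UNIV :: 'n set) \<rightarrow>\<^sub>E {..k})"
    by (intro finite_PiE) auto
  ultimately have "finite (Poly_Mapping.lookup ` (exponents k :: ('n \<Rightarrow>\<^sub>0 nat) set))"
    by (rule finite_subset)
  then show ?thesis
    by (rule finite_imageD) (simp add: inj_on_def)
qed

lemma Var_prod_list:
  "prod_list (map Var ns) = Poly_Mapping.single (\<Sum>i\<leftarrow>ns. Poly_Mapping.single i 1) 1"
  by (induction ns) (simp_all add: Var_def mult_single)

lemma lookup_exponent: "Poly_Mapping.lookup (\<Sum>i\<leftarrow>ns. Poly_Mapping.single i (1::nat)) j = count_list ns j"
  by (induction ns) (auto simp: lookup_add lookup_single when_def)

lemma sorted_index_list: "sorted (index_list m)"
proof -
  have "sorted (concat (map (\<lambda>i. replicate (f i) i) xs))" if "sorted xs" for f and xs :: "'a list"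
    using that by (induction xs) (auto simp: sorted_append)
  then show ?thesis
    by (simp add: index_list_def)
qed

lemma count_index_list: "count_list (index_list m) j = Poly_Mapping.lookup m j"
proof -
  have rep: "count_list (replicate n i) j = (if i = j then n else 0)" for n and i :: 'a
    by (induction n) auto
  have "count_list (concat (map (\<lambda>i. replicate (f i) i) xs)) j = (if j \<in> set xs then f j else 0)"
    if "distinct xs" for f and xs :: "'a list"
    using that by (induction xs) (auto simp: rep)
  then show ?thesis
    by (simp add: index_list_def)
qed

lemma index_list_exponent:
  assumes "sorted ns"
  shows "index_list (\<Sum>i\<leftarrow>ns. Poly_Mapping.single i 1) = ns"
proof -
  have "mset (index_list (\<Sum>i\<leftarrow>ns. Poly_Mapping.single i 1)) = mset ns"
    by (intro multiset_eqI) (simp only: count_mset count_index_list lookup_exponent)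
  then show ?thesis
    using assms sorted_index_list properties_for_sort by metis
qed

lemma induced_form_basis:
  fixes ns ms :: "'n::{finite,linorder} list"
  assumes "sorted ns" "length ns = k" "sorted ms" "length ms = k"
  shows "induced_form B x k (prod_list (map Var ns)) (prod_list (map Var ms)) =
    pairing_sum B (map x (ns @ ms))"
proof -
  let ?e = "\<lambda>ns :: 'n list. \<Sum>i\<leftarrow>ns. Poly_Mapping.single i (1::nat)"
  have mem: "?e us \<in> exponents k" if "length us = k" for us
    unfolding exponents_def mi_length_def mem_Collect_eq lookup_exponent
    using that sum_count_set[of us UNIV] by simp
  have "induced_form B x k (prod_list (map Var ns)) (prod_list (map Var ms)) =
    (\<Sum>m\<in>exponents k. \<Sum>m'\<in>exponents k. if m = ?e ns then (if m' = ?e ms then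
      pairing_sum B (map x (index_list m @ index_list m')) else 0) else 0)"
    unfolding induced_form_def Var_prod_list
    by (intro sum.cong refl) (auto simp: lookup_single when_def)
  also have "\<dots> = (\<Sum>m\<in>exponents k. if m = ?e ns then (\<Sum>m'\<in>exponents k. if m' = ?e ms then
      pairing_sum B (map x (index_list m @ index_list m')) else 0) else 0)"
    by (intro sum.cong refl) auto
  also have "\<dots> = pairing_sum B (map x (index_list (?e ns) @ index_list (?e ms)))"
    using mem assms by (simp only: sum.delta finite_exponents if_True)
  finally show ?thesis
    using assms by (simp only: index_list_exponent)
qed

end

theory Submission
  imports Defs "HOL-Probability.Distributions"
begin

text \<open>Factor \<open>G = A A\<^sup>T\<close>, where \<open>A\<^sup>-\<^sup>1\<close> is the transpose of a matrix whose columns form a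
  \<open>G\<close>-orthonormal basis. The substitution \<open>y = A z\<close> turns \<open>\<mu>\<close> into \<open>c\<close> times the standard Gaussian
  measure, and the coordinates \<open>y\<^sub>i\<close> into the linear forms \<open>z \<bullet> a\<^sub>i\<close>, where the rows \<open>a\<^sub>i\<close> of \<open>A\<close>
  satisfy \<open>a\<^sub>i \<bullet> a\<^sub>j = G\<^sub>i\<^sub>j\<close>. What remains is Wick's formula for the standard Gaussian measure.
  Both the moment of a product of linear forms and the sum over pairings obey the same recursion:
  pair the first factor with each of the others. For the moments this recursion is multilinear in
  the forms, so they may be taken to be coordinates, where it reduces to
  \<open>m\<^sub>k\<^sub>+\<^sub>1 = k m\<^sub>k\<^sub>-\<^sub>1\<close> for the moments of the one-dimensional normal distribution.\<close>

subsection \<open>Moments of the standard Gaussian measure\<close>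

text \<open>The density is a product over coordinates, so that integrals of products of coordinate
  functions split into one-dimensional ones. That the total mass is 1 comes out later as Wick's
  formula for the empty product.\<close>

definition std_gaussian :: "'a::euclidean_space measure"
  where "std_gaussian = density lborel (\<lambda>z. ennreal (\<Prod>b\<in>Basis. std_normal_density (z \<bullet> b)))"

lemma sets_std_gaussian [simp, measurable_cong]: "sets std_gaussian = sets borel"
  by (simp add: std_gaussian_def)

definition normal_moment :: "nat \<Rightarrow> real"
  where "normal_moment k = (\<integral>t. std_normal_density t * t ^ k \<partial>lborel)"

lemma normal_moment_even: "normal_moment (2 * k) = fact (2 * k) / (2 ^ k * fact k)"
  unfolding normal_moment_def by (rule integral_std_normal_moment_even)

lemma normal_moment_odd: "normal_moment (2 * k + 1) = 0"
  unfolding normal_moment_def by (rule integral_std_normal_moment_odd)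

text \<open>Integration by parts would give this; here it is read off from the closed forms of the
  even and odd moments. At \<open>k = 0\<close> the truncated \<open>k - 1\<close> is harmless
  because of the factor \<open>k\<close>.\<close>

lemma normal_moment_Suc: "normal_moment (Suc k) = k * normal_moment (k - 1)"
proof (cases "even k")
  case True
  then obtain m where m: "k = 2 * m" ..
  have "normal_moment (k - 1) = 0" if "m > 0"
  proof -
    have "k - 1 = 2 * (m - 1) + 1"
      using that m by simp
    then show ?thesis
      by (simp only: normal_moment_odd)
  qed
  then show ?thesis
    using normal_moment_odd[of m] by (cases "m = 0") (auto simp: m)
next
  case False
  then obtain m where m: "k = 2 * m + 1"
    by (elim oddE)
  have "normal_moment (2 * Suc m) = (2 * m + 1) * normal_moment (2 * m)"
  proof -
    have "fact (2 * Suc m) = (2 * real (Suc m)) * ((2 * m + 1) * fact (2 * m))"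
      by (simp add: algebra_simps)
    moreover have "2 ^ Suc m * fact (Suc m) = (2 * real (Suc m)) * (2 ^ m * fact m)"
      by simp
    ultimately show ?thesis
      unfolding normal_moment_even by (simp only: times_divide_eq_right mult_divide_mult_cancel_left) auto
  qed
  then show ?thesis
    by (simp add: m)
qed

text \<open>Fubini: Lebesgue measure on \<open>'a\<close> is the image of a product of
  one-dimensional Lebesgue measures under the map that assembles a vector from its
  coordinates.\<close>

lemma integrable_lborel_prod:
  fixes f :: "'a::euclidean_space \<Rightarrow> real \<Rightarrow> real"
  assumes "\<And>b. b \<in> Basis \<Longrightarrow> integrable lborel (f b)"
  shows "integrable lborel (\<lambda>z. \<Prod>b\<in>Basis. f b (z \<bullet> b))"
    and "(\<integral>z. (\<Prod>b\<in>Basis. f b (z \<bullet> b)) \<partial>lborel) = (\<Prod>b\<in>Basis. \<integral>t. f b t \<partial>lborel)"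
proof -
  interpret product_sigma_finite "\<lambda>_::'a. lborel :: real measure"
    by standard
  let ?e = "\<lambda>y. \<Sum>b\<in>Basis. y b *\<^sub>R b :: 'a"
  have meas: "f b \<in> borel_measurable borel" if "b \<in> Basis" for b
    using borel_measurable_integrable[OF assms[OF that]] by simp
  have [measurable]: "(\<lambda>z. \<Prod>b\<in>Basis. f b (z \<bullet> b)) \<in> borel_measurable borel"
    by (intro borel_measurable_prod measurable_compose[OF _ meas]) auto
  have e: "(\<Prod>b\<in>Basis. f b (?e y \<bullet> b)) = (\<Prod>b\<in>Basis. f b (y b))" for y
    by (intro prod.cong refl) simp
  show "integrable lborel (\<lambda>z. \<Prod>b\<in>Basis. f b (z \<bullet> b))"
    by (subst lborel_eq) (simp add: integrable_distr_eq e product_integrable_prod assms)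
  show "(\<integral>z. (\<Prod>b\<in>Basis. f b (z \<bullet> b)) \<partial>lborel) = (\<Prod>b\<in>Basis. \<integral>t. f b t \<partial>lborel)"
    by (subst lborel_eq) (simp add: integral_distr e product_integral_prod assms)
qed

lemma std_gaussian_monomial:
  fixes \<gamma> :: "'a::euclidean_space \<Rightarrow> nat"
  shows "integrable std_gaussian (\<lambda>z. \<Prod>b\<in>Basis. (z \<bullet> b) ^ \<gamma> b)" (is ?int)
    and "(\<integral>z. (\<Prod>b\<in>Basis. (z \<bullet> b) ^ \<gamma> b) \<partial>std_gaussian) = (\<Prod>b\<in>Basis. normal_moment (\<gamma> b))" (is ?eq)
proof -
  have nonneg: "0 \<le> (\<Prod>b\<in>Basis. std_normal_density (z \<bullet> b))" for z :: 'a
    by (intro prod_nonneg) simp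
  note P = integrable_lborel_prod[of "\<lambda>(b::'a) t. std_normal_density t * t ^ \<gamma> b", OF integrable_std_normal_moment,
      unfolded prod.distrib]
  show ?int
    using P(1) by (simp add: std_gaussian_def integrable_density nonneg)
  show ?eq
    using P(2) by (simp add: std_gaussian_def integral_density nonneg normal_moment_def)
qed

lemma prod_inner_Basis:
  assumes "finite S" "v ` S \<subseteq> Basis"
  shows "(\<Prod>i\<in>S. z \<bullet> v i) = (\<Prod>b\<in>Basis. (z \<bullet> b) ^ card {i\<in>S. v i = b})"
proof -
  have "(\<Prod>i\<in>S. z \<bullet> v i) = (\<Prod>b\<in>Basis. \<Prod>i\<in>{i\<in>S. v i = b}. z \<bullet> v i)"
    using prod.group[OF assms(1) finite_Basis assms(2), of "\<lambda>i. z \<bullet> v i"] by simp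
  also have "\<dots> = (\<Prod>b\<in>Basis. (z \<bullet> b) ^ card {i\<in>S. v i = b})"
    by (intro prod.cong refl) simp
  finally show ?thesis .
qed

text \<open>Meant for claims that are linear in each \<open>v i\<close>: the assumption
  \<open>step\<close> is then met by expanding one vector in the basis, and one position after
  another is specialised to basis vectors.\<close>

lemma multilinear_induct:
  fixes v :: "'i \<Rightarrow> 'a::euclidean_space"
  assumes "finite S"
    and base: "\<And>v. v ` S \<subseteq> Basis \<Longrightarrow> P v"
    and step: "\<And>v i. i \<in> S \<Longrightarrow> (\<And>b. b \<in> Basis \<Longrightarrow> P (v(i := b))) \<Longrightarrow> P v"
  shows "P v"
proof -
  \<comment> \<open>\<open>T\<close> is the set of positions where \<open>v\<close> may still be
    arbitrary; on the rest of \<open>S\<close> it already takes values in the basis.\<close>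
  have "P v" if "T \<subseteq> S" "v ` (S - T) \<subseteq> Basis" for T v
    using finite_subset[OF that(1) assms(1)] that
  proof (induction T arbitrary: v rule: finite_induct)
    case empty
    then show ?case by (simp add: base)
  next
    case (insert t T)
    show ?case
    proof (rule step)
      show "t \<in> S"
        using insert.prems by simp
      fix b :: 'a assume "b \<in> Basis"
      then show "P (v(t := b))"
        using insert.prems by (intro insert.IH) auto
    qed
  qed
  from this[of S v] show ?thesis by simp
qed

lemma prod_inner_expand:
  fixes v :: "'i \<Rightarrow> 'a::euclidean_space"
  assumes "finite S" "i \<in> S"
  shows "(\<Prod>j\<in>S. z \<bullet> v j) = (\<Sum>b\<in>Basis. (v i \<bullet> b) * (\<Prod>j\<in>S. z \<bullet> (v(i := b)) j))"
proof -
  have "(\<Prod>j\<in>S. z \<bullet> (v(i := b)) j) = (z \<bullet> b) * (\<Prod>j\<in>S - {i}. z \<bullet> v j)" for b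
    using assms by (simp add: prod.remove)
  moreover have "(\<Prod>j\<in>S. z \<bullet> v j) = (z \<bullet> v i) * (\<Prod>j\<in>S - {i}. z \<bullet> v j)"
    using assms by (rule prod.remove)
  ultimately show ?thesis
    by (simp add: euclidean_inner[of z "v i"] sum_distrib_left sum_distrib_right mult_ac)
qed

lemma integrable_prod_inner:
  fixes v :: "'i \<Rightarrow> 'a::euclidean_space"
  assumes "finite S"
  shows "integrable std_gaussian (\<lambda>z. \<Prod>i\<in>S. z \<bullet> v i)"
proof (rule multilinear_induct[OF assms, of _ v])
  fix v :: "'i \<Rightarrow> 'a"
  assume "v ` S \<subseteq> Basis"
  then show "integrable std_gaussian (\<lambda>z. \<Prod>i\<in>S. z \<bullet> v i)"
    using assms by (simp only: prod_inner_Basis std_gaussian_monomial)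
next
  fix v :: "'i \<Rightarrow> 'a" and i
  assume "i \<in> S" "\<And>b. b \<in> Basis \<Longrightarrow> integrable std_gaussian (\<lambda>z. \<Prod>j\<in>S. z \<bullet> (v(i := b)) j)"
  then show "integrable std_gaussian (\<lambda>z. \<Prod>i\<in>S. z \<bullet> v i)"
    by (subst prod_inner_expand[OF assms]) auto
qed

lemma integral_prod_inner_expand:
  fixes v :: "'i \<Rightarrow> 'a::euclidean_space"
  assumes "finite S" "i \<in> S"
  shows "(\<integral>z. (\<Prod>j\<in>S. z \<bullet> v j) \<partial>std_gaussian) =
    (\<Sum>b\<in>Basis. (v i \<bullet> b) * (\<integral>z. (\<Prod>j\<in>S. z \<bullet> (v(i := b)) j) \<partial>std_gaussian))"
  by (subst prod_inner_expand[OF assms])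
    (simp add: integrable_prod_inner[OF assms(1)] del: fun_upd_apply)

lemma integral_prod_inner_Basis:
  fixes v :: "'i \<Rightarrow> 'a::euclidean_space"
  assumes "finite S" "v ` S \<subseteq> Basis"
  shows "(\<integral>z. (\<Prod>i\<in>S. z \<bullet> v i) \<partial>std_gaussian) = (\<Prod>b\<in>Basis. normal_moment (card {i\<in>S. v i = b}))"
  by (simp only: prod_inner_Basis[OF assms] std_gaussian_monomial)

text \<open>Both sides are linear in every vector, so basis vectors suffice. If \<open>v a\<close>
  occurs g times among the \<open>v j\<close> with \<open>j\<close> in \<open>S\<close>, then
  exactly these \<open>j\<close> contribute on the right, all with the same value, and the claim
  becomes \<open>normal_moment_Suc\<close> with k = g in the coordinate along
  \<open>v a\<close>.\<close>

lemma std_gaussian_wick_step: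
  fixes v :: "'i \<Rightarrow> 'a::euclidean_space"
  assumes S: "finite S" and a: "a \<notin> S"
  shows "(\<integral>z. (\<Prod>i\<in>insert a S. z \<bullet> v i) \<partial>std_gaussian) =
    (\<Sum>j\<in>S. (v a \<bullet> v j) * (\<integral>z. (\<Prod>i\<in>S - {j}. z \<bullet> v i) \<partial>std_gaussian))"
    (is "?L v = (\<Sum>j\<in>S. ?R j v)")
proof (rule multilinear_induct[of "insert a S" _ v])
  show "finite (insert a S)"
    using S by simp
next
  fix v :: "'i \<Rightarrow> 'a"
  assume v: "v ` insert a S \<subseteq> Basis"
  \<comment> \<open>The multiplicities \<open>?\<gamma>\<close> leave out the position
    \<open>a\<close>, so on the left the one at \<open>v a\<close> goes up by 1, and on the right
    removing \<open>j\<close> lowers it by 1. \<open>?M\<close> collects the other coordinates and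
    is common to both sides.\<close>
  let ?\<gamma> = "\<lambda>b. card {i\<in>S. v i = b}"
  let ?M = "\<Prod>b\<in>Basis - {v a}. normal_moment (?\<gamma> b)"
  have va: "v a \<in> Basis"
    using v by simp
  have "{i \<in> insert a S. v i = b} = (if b = v a then insert a {i\<in>S. v i = b} else {i\<in>S. v i = b})" for b
    by auto
  then have "card {i \<in> insert a S. v i = b} = (if b = v a then Suc (?\<gamma> b) else ?\<gamma> b)" for b
    using S a by simp
  then have L: "?L v = normal_moment (Suc (?\<gamma> (v a))) * ?M"
    using S v va by (subst integral_prod_inner_Basis) (auto simp: prod.remove[OF _ va])
  have "?R j v = (if v j = v a then normal_moment (?\<gamma> (v a) - 1) * ?M else 0)" if j: "j \<in> S" for j
  proof (cases "v j = v a")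
    case True
    have "{i \<in> S - {j}. v i = b} = (if b = v a then {i\<in>S. v i = b} - {j} else {i\<in>S. v i = b})" for b
      using True by auto
    then have "card {i \<in> S - {j}. v i = b} = (if b = v a then ?\<gamma> b - 1 else ?\<gamma> b)" for b
      using S j True by simp
    then show ?thesis
      using S v va True by (subst integral_prod_inner_Basis) (auto simp: prod.remove[OF _ va])
  next
    case False
    then show ?thesis
      using v j by (auto simp: inner_Basis)
  qed
  then have "(\<Sum>j\<in>S. ?R j v) = ?\<gamma> (v a) * (normal_moment (?\<gamma> (v a) - 1) * ?M)"
    using S by (simp add: sum.If_cases Int_def)
  then show "?L v = (\<Sum>j\<in>S. ?R j v)"
    unfolding L normal_moment_Suc by simp
next
  fix v :: "'i \<Rightarrow> 'a" and i
  assume i: "i \<in> insert a S"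
    and IH: "\<And>b. b \<in> Basis \<Longrightarrow> ?L (v(i := b)) = (\<Sum>j\<in>S. ?R j (v(i := b)))"
  have upd: "(\<integral>z. (\<Prod>k\<in>U. z \<bullet> (v(i := b)) k) \<partial>std_gaussian) = (\<integral>z. (\<Prod>k\<in>U. z \<bullet> v k) \<partial>std_gaussian)"
    if "i \<notin> U" for U b
  proof -
    have "(\<Prod>k\<in>U. z \<bullet> (v(i := b)) k) = (\<Prod>k\<in>U. z \<bullet> v k)" for z
      using that by (intro prod.cong refl) (metis fun_upd_other)
    then show ?thesis
      by simp
  qed
  \<comment> \<open>Position \<open>i\<close> enters each summand exactly once: in the inner product
    if \<open>i\<close> is \<open>a\<close> or \<open>j\<close>, otherwise in the remaining
    integral. Hence each summand is linear in \<open>v i\<close>.\<close>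
  have R: "?R j v = (\<Sum>b\<in>Basis. (v i \<bullet> b) * ?R j (v(i := b)))" if j: "j \<in> S" for j
  proof (cases "i = a \<or> i = j")
    case True
    then have notin: "i \<notin> S - {j}"
      using a by auto
    have "j \<noteq> a"
      using a j by auto
    then have "v a \<bullet> v j = (\<Sum>b\<in>Basis. (v i \<bullet> b) * ((v(i := b)) a \<bullet> (v(i := b)) j))"
      using True euclidean_inner[of "v a" "v j"] by (auto simp: inner_commute mult.commute)
    then show ?thesis
      by (simp only: upd[OF notin] sum_distrib_right mult.assoc)
  next
    case False
    then have "i \<in> S - {j}" and "a \<noteq> i" "j \<noteq> i"
      using i by auto
    then show ?thesis
      using integral_prod_inner_expand[OF _ \<open>i \<in> S - {j}\<close>, of v] S
      by (simp add: sum_distrib_left mult_ac)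
  qed
  have "?L v = (\<Sum>b\<in>Basis. (v i \<bullet> b) * (\<Sum>j\<in>S. ?R j (v(i := b))))"
    by (subst integral_prod_inner_expand[OF _ i]) (simp_all add: IH S del: fun_upd_apply)
  also have "\<dots> = (\<Sum>j\<in>S. \<Sum>b\<in>Basis. (v i \<bullet> b) * ?R j (v(i := b)))"
    unfolding sum_distrib_left by (rule sum.swap)
  also have "\<dots> = (\<Sum>j\<in>S. ?R j v)"
    by (simp only: R cong: sum.cong)
  finally show "?L v = (\<Sum>j\<in>S. ?R j v)" .
qed

subsection \<open>Pairings\<close>

text \<open>Unlike in \<open>pairing_sum\<close>, the positions form an arbitrary set, because the
  recursion removes positions from anywhere in it.\<close>

definition pairings :: "(nat \<Rightarrow> nat \<Rightarrow> real) \<Rightarrow> nat set \<Rightarrow> real"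
  where "pairings f S = (\<Sum>P\<in>pair_partitions S. \<Prod>p\<in>P. f (Min p) (Max p))"

lemma finite_pair_partitions: "finite S \<Longrightarrow> finite (pair_partitions S)"
  unfolding pair_partitions_def by (rule finite_subset[OF _ finitely_many_partition_on[of S]]) auto

lemma pair_partitions_subset: "P \<in> pair_partitions S \<Longrightarrow> p \<in> P \<Longrightarrow> p \<subseteq> S"
  by (auto simp: pair_partitions_def dest: partition_onD1)

text \<open>A pairing amounts to the choice of a partner \<open>j\<close> for \<open>a\<close> and a
  pairing of the remaining positions; deleting the block that contains \<open>a\<close> inverts the
  map.\<close>

lemma bij_betw_pair_partitions_insert:
  assumes a: "a \<notin> S"
  shows "bij_betw (\<lambda>(j, P). insert {a, j} P) (SIGMA j:S. pair_partitions (S - {j})) (pair_partitions (insert a S))"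
  unfolding bij_betw_def
proof
  \<comment> \<open>The blocks of \<open>P\<close> miss \<open>a\<close>, so \<open>{a, j}\<close>
    is the only block of \<open>insert {a, j} P\<close> that contains \<open>a\<close>. Both
    \<open>j\<close> and \<open>P\<close> can therefore be recovered.\<close>
  have notin: "p \<notin> P" if "P \<in> pair_partitions (S - {j})" "a \<in> p" for P p j
    using pair_partitions_subset[OF that(1)] a that(2) by blast
  show "inj_on (\<lambda>(j, P). insert {a, j} P) (SIGMA j:S. pair_partitions (S - {j}))"
  proof (rule inj_onI, clarify)
    fix j P k Q
    assume P: "P \<in> pair_partitions (S - {j})" and Q: "Q \<in> pair_partitions (S - {k})"
      and eq: "insert {a, j} P = insert {a, k} Q"
    have "{a, j} \<in> insert {a, k} Q"
      using eq by blast
    then have jk: "{a, j} = {a, k}"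
      using notin[OF Q, of "{a, j}"] by blast
    then have "P = Q"
      using eq notin[OF P, of "{a, j}"] notin[OF Q, of "{a, k}"] by (simp add: insert_ident)
    then show "j = k \<and> P = Q"
      using jk by (auto simp: doubleton_eq_iff)
  qed
  show "(\<lambda>(j, P). insert {a, j} P) ` (SIGMA j:S. pair_partitions (S - {j})) = pair_partitions (insert a S)"
  proof (intro equalityI subsetI)
    fix R assume "R \<in> (\<lambda>(j, P). insert {a, j} P) ` (SIGMA j:S. pair_partitions (S - {j}))"
    then obtain j P where j: "j \<in> S" and P: "P \<in> pair_partitions (S - {j})" and R: "R = insert {a, j} P"
      by auto
    have "\<Union>P = S - {j}"
      using P partition_onD1 by (auto simp: pair_partitions_def)
    moreover have "insert a S - {a, j} = S - {j}"
      using a by auto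
    ultimately have "partition_on (insert a S) R"
      using P j a unfolding R by (subst partition_on_insert) (auto simp: pair_partitions_def disjnt_def)
    moreover have "a \<noteq> j"
      using a j by blast
    ultimately show "R \<in> pair_partitions (insert a S)"
      using P by (auto simp: pair_partitions_def R)
  next
    fix R assume R: "R \<in> pair_partitions (insert a S)"
    then have part: "partition_on (insert a S) R"
      by (simp add: pair_partitions_def)
    then obtain p where p: "p \<in> R" "a \<in> p"
      using partition_onD1 by blast
    then have "card p = 2"
      using R by (simp add: pair_partitions_def)
    then obtain j where j: "p = {a, j}" "a \<noteq> j"
      using p(2) by (auto simp: card_2_iff)
    have "j \<in> S"
      using pair_partitions_subset[OF R p(1)] j by auto
    have "disjnt p (\<Union>(R - {p}))"
      using partition_onD2[OF part] p(1) by (auto simp: disjoint_def disjnt_def)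
    then have "partition_on (insert a S - p) (R - {p})"
      using partition_on_insert[of p "R - {p}" "insert a S"] part p(1) by (simp add: insert_absorb)
    moreover have "insert a S - p = S - {j}"
      using j a by auto
    ultimately have "R - {p} \<in> pair_partitions (S - {j})"
      using R by (simp add: pair_partitions_def)
    then show "R \<in> (\<lambda>(j, P). insert {a, j} P) ` (SIGMA j:S. pair_partitions (S - {j}))"
      using \<open>j \<in> S\<close> p(1) j(1) by (intro image_eqI[of _ _ "(j, R - {p})"]) auto
  qed
qed

lemma pairings_empty: "pairings f {} = 1"
proof -
  have "pair_partitions {} = {{}}"
    by (auto simp: pair_partitions_def partition_on_empty)
  then show ?thesis
    by (simp add: pairings_def)
qed

text \<open>The sum is split according to the partner \<open>j\<close> of \<open>a\<close>. Since
  \<open>a\<close> lies below all of \<open>S\<close>, it is the minimum of the block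
  \<open>{a, j}\<close>, whose factor is therefore \<open>f a j\<close>.\<close>

lemma pairings_insert:
  assumes S: "finite S" and a: "\<And>j. j \<in> S \<Longrightarrow> a < j"
  shows "pairings f (insert a S) = (\<Sum>j\<in>S. f a j * pairings f (S - {j}))"
proof -
  have "a \<notin> S"
    using a by blast
  have "pairings f (insert a S) = (\<Sum>(j, P)\<in>(SIGMA j:S. pair_partitions (S - {j})).
      \<Prod>p\<in>insert {a, j} P. f (Min p) (Max p))"
    unfolding pairings_def
    by (subst sum.reindex_bij_betw[OF bij_betw_pair_partitions_insert[OF \<open>a \<notin> S\<close>], symmetric])
      (simp add: case_prod_unfold)
  also have "\<dots> = (\<Sum>j\<in>S. \<Sum>P\<in>pair_partitions (S - {j}). \<Prod>p\<in>insert {a, j} P. f (Min p) (Max p))"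
    using S by (intro sum.Sigma[symmetric]) (auto intro: finite_pair_partitions)
  also have "\<dots> = (\<Sum>j\<in>S. f a j * pairings f (S - {j}))"
    unfolding pairings_def sum_distrib_left
  proof (intro sum.cong refl)
    fix j P assume j: "j \<in> S" and P: "P \<in> pair_partitions (S - {j})"
    have "finite P"
      using S P by (auto simp: pair_partitions_def intro: finite_elements)
    moreover have "{a, j} \<notin> P"
      using pair_partitions_subset[OF P] \<open>a \<notin> S\<close> by blast
    moreover have "Min {a, j} = a" "Max {a, j} = j"
      using a[OF j] by auto
    ultimately show "(\<Prod>p\<in>insert {a, j} P. f (Min p) (Max p)) = f a j * (\<Prod>p\<in>P. f (Min p) (Max p))"
      by simp
  qed
  finally show ?thesis .
qed

text \<open>By \<open>std_gaussian_wick_step\<close> and \<open>pairings_insert\<close>, both sides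
  satisfy the same recursion, and both are 1 on the empty set.\<close>

lemma std_gaussian_wick:
  fixes v :: "nat \<Rightarrow> 'a::euclidean_space"
  assumes "finite S"
  shows "(\<integral>z. (\<Prod>i\<in>S. z \<bullet> v i) \<partial>std_gaussian) = pairings (\<lambda>i j. v i \<bullet> v j) S"
  using assms
proof (induction S rule: finite_psubset_induct)
  case (psubset S)
  show ?case
  proof (cases "S = {}")
    case True
    have "normal_moment 0 = 1"
      using normal_moment_even[of 0] by simp
    then show ?thesis
      using std_gaussian_monomial(2)[of "\<lambda>_::'a. 0"] True by (simp add: pairings_empty)
  next
    case False
    \<comment> \<open>The Gaussian recursion can split off any position;
      \<open>pairings_insert\<close> asks for the least one.\<close>
    define a where "a = Min S"
    have a: "a \<in> S"
      using psubset.hyps False by (simp add: a_def)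
    have min: "a < j" if "j \<in> S - {a}" for j
      using that psubset.hyps Min_le[of S j] by (auto simp: a_def less_le)
    have "(\<integral>z. (\<Prod>i\<in>insert a (S - {a}). z \<bullet> v i) \<partial>std_gaussian) =
        (\<Sum>j\<in>S - {a}. (v a \<bullet> v j) * (\<integral>z. (\<Prod>i\<in>S - {a} - {j}. z \<bullet> v i) \<partial>std_gaussian))"
      using psubset.hyps by (intro std_gaussian_wick_step) auto
    also have "\<dots> = (\<Sum>j\<in>S - {a}. (v a \<bullet> v j) * pairings (\<lambda>i j. v i \<bullet> v j) (S - {a} - {j}))"
      using a by (intro sum.cong refl arg_cong2[of _ _ _ _ times] psubset.IH) auto
    also have "\<dots> = pairings (\<lambda>i j. v i \<bullet> v j) (insert a (S - {a}))"
      using psubset.hyps min by (intro pairings_insert[symmetric]) auto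
    finally show ?thesis
      using a by (simp add: insert_absorb)
  qed
qed

subsection \<open>Linear change of variables\<close>

text \<open>By Tonelli the coordinate along \<open>b\<close> may be integrated first. With the other
  coordinates fixed, among them the one along \<open>b'\<close>, the shear is a translation of the
  real line.\<close>

lemma nn_integral_lborel_shear:
  fixes f :: "'a::euclidean_space \<Rightarrow> ennreal"
  assumes [measurable]: "f \<in> borel_measurable borel" and b: "b \<in> Basis" "b' \<in> Basis" "b \<noteq> b'"
  shows "(\<integral>\<^sup>+z. f (z + (c * (z \<bullet> b')) *\<^sub>R b) \<partial>lborel) = (\<integral>\<^sup>+z. f z \<partial>lborel)"
proof -
  interpret product_sigma_finite "\<lambda>_::'a. lborel :: real measure"
    by standard
  let ?I = "Basis - {b}" and ?e = "\<lambda>y. \<Sum>k\<in>Basis. y k *\<^sub>R k :: 'a"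
  let ?P = "\<lambda>I. \<Pi>\<^sub>M k\<in>I. (lborel :: real measure)"
  let ?r = "\<lambda>x. \<Sum>k\<in>?I. x k *\<^sub>R k"
  have I: "insert b ?I = Basis"
    using b by auto
  have e: "?e (x(b := t)) = t *\<^sub>R b + ?r x" for x t
    using b(1) by (simp add: sum.remove[of Basis b])
  have eb': "?e (x(b := t)) \<bullet> b' = x b'" for x t
    using b by simp
  have rev: "(\<integral>\<^sup>+z. g z \<partial>lborel) = (\<integral>\<^sup>+x. \<integral>\<^sup>+t. g (?e (x(b := t))) \<partial>lborel \<partial>?P ?I)"
    if [measurable]: "g \<in> borel_measurable borel" for g :: "'a \<Rightarrow> ennreal"
  proof -
    have "(\<integral>\<^sup>+z. g z \<partial>lborel) = (\<integral>\<^sup>+x. g (?e x) \<partial>?P Basis)"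
      by (subst lborel_eq) (simp add: nn_integral_distr)
    also have "\<dots> = (\<integral>\<^sup>+x. \<integral>\<^sup>+t. g (?e (x(b := t))) \<partial>lborel \<partial>?P ?I)"
      using product_nn_integral_insert[of ?I b "\<lambda>x. g (?e x)"] unfolding I by simp
    finally show ?thesis .
  qed
  have "(\<integral>\<^sup>+t. f (?e (x(b := t)) + (c * (?e (x(b := t)) \<bullet> b')) *\<^sub>R b) \<partial>lborel) =
      (\<integral>\<^sup>+t. f (?e (x(b := t))) \<partial>lborel)" for x
    unfolding eb' unfolding e
    using nn_integral_real_affine[of "\<lambda>t. f (t *\<^sub>R b + ?r x)" 1 "c * x b'"]
    by (simp add: algebra_simps)
  then show ?thesis
    by (subst (1 2) rev) simp_all
qed

lemma prod_Basis_cart: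
  fixes f :: "real ^ 'n \<Rightarrow> 'a::comm_monoid_mult"
  shows "(\<Prod>b\<in>Basis. f b) = (\<Prod>i\<in>UNIV. f (axis i 1))"
proof -
  have Basis: "(Basis :: (real ^ 'n) set) = range (\<lambda>i. axis i 1)"
    by (auto simp: Basis_vec_def)
  show ?thesis
    unfolding Basis by (subst prod.reindex) (auto simp: inj_on_def axis_eq_axis)
qed

lemma sum_Basis_cart:
  fixes f :: "real ^ 'n \<Rightarrow> 'a::comm_monoid_add"
  shows "(\<Sum>b\<in>Basis. f b) = (\<Sum>i\<in>UNIV. f (axis i 1))"
proof -
  have Basis: "(Basis :: (real ^ 'n) set) = range (\<lambda>i. axis i 1)"
    by (auto simp: Basis_vec_def)
  show ?thesis
    unfolding Basis by (subst sum.reindex) (auto simp: inj_on_def axis_eq_axis)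
qed

text \<open>Lebesgue measure is determined by the volumes of boxes, and the preimage of a box is a
  box with the same side lengths in permuted order.\<close>

lemma lborel_distr_transpose:
  "distr lborel borel (\<lambda>z::real ^ 'n. \<chi> i. z $ Transposition.transpose m n i) = lborel"
proof (rule lborel_eqI[symmetric])
  let ?\<tau> = "Transposition.transpose m n"
  let ?T = "\<lambda>z::real ^ 'n. \<chi> i. z $ ?\<tau> i"
  have perm: "?\<tau> permutes UNIV"
    by (simp add: permutes_swap_id)
  have "linear ?T"
    by (rule linearI) (simp_all add: vec_eq_iff)
  then have [measurable]: "?T \<in> borel \<rightarrow>\<^sub>M borel"
    by (intro borel_measurable_continuous_onI linear_continuous_on linear_conv_bounded_linear[THEN iffD1])
  fix l u :: "real ^ 'n"
  assume le: "\<And>b. b \<in> Basis \<Longrightarrow> l \<bullet> b \<le> u \<bullet> b"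
  then have le': "l $ i \<le> u $ i" for i
    by (metis axis_in_Basis_iff cart_eq_inner_axis Basis_real_def singletonI)
  have "(?T z \<in> box l u) = (z \<in> box (?T l) (?T u))" for z
  proof -
    have "(\<forall>i. l $ i < z $ ?\<tau> i \<and> z $ ?\<tau> i < u $ i) = (\<forall>i. l $ ?\<tau> i < z $ i \<and> z $ i < u $ ?\<tau> i)"
      by (metis transpose_involutory)
    then show ?thesis
      by (simp add: mem_box_cart)
  qed
  then have "?T -` box l u = box (?T l) (?T u)"
    by blast
  then have "emeasure (distr lborel borel ?T) (box l u) = emeasure lborel (box (?T l) (?T u))"
    by (simp add: emeasure_distr)
  also have "\<dots> = ennreal (\<Prod>b\<in>Basis. (?T u - ?T l) \<bullet> b)"
    using le' by (intro emeasure_lborel_box) (auto simp: Basis_vec_def inner_axis)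
  also have "(\<Prod>b\<in>Basis. (?T u - ?T l) \<bullet> b) = (\<Prod>i\<in>UNIV. (u - l) $ ?\<tau> i)"
    by (simp add: prod_Basis_cart inner_axis)
  also have "\<dots> = (\<Prod>i\<in>UNIV. (u - l) $ i)"
    using prod.permute[OF perm, of "\<lambda>i. (u - l) $ i"] by (simp add: o_def)
  also have "\<dots> = (\<Prod>b\<in>Basis. (u - l) \<bullet> b)"
    by (simp add: prod_Basis_cart inner_axis)
  finally show "emeasure (distr lborel borel ?T) (box l u) = ennreal (\<Prod>b\<in>Basis. (u - l) \<bullet> b)" .
qed simp

lemma borel_measurable_matrix_vector_mult [measurable]:
  "(*v) (A :: real ^ 'n ^ 'm) \<in> borel \<rightarrow>\<^sub>M borel"
  by (intro borel_measurable_continuous_onI linear_continuous_on linear_conv_bounded_linear[THEN iffD1]) simp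

text \<open>The change of variables in HOL-Analysis requires the index type to be of class
  \<open>wellorder\<close>, which the finite linear order \<open>'n\<close> of the theorem is not known to be.\<close>

lemma nn_integral_lborel_matrix:
  fixes A :: "real ^ 'n ^ 'n" and f :: "real ^ 'n \<Rightarrow> ennreal"
  assumes "det A \<noteq> 0" "f \<in> borel_measurable borel"
  shows "(\<integral>\<^sup>+y. f y \<partial>lborel) = ennreal \<bar>det A\<bar> * (\<integral>\<^sup>+z. f (A *v z) \<partial>lborel)"
proof -
  \<comment> \<open>The matrix is factored into elementary ones. Keeping
    \<open>det A \<noteq> 0\<close> inside the claim makes it vacuous for a zero row, and in a
    nonsingular product both factors are nonsingular.\<close>
  define P where "P A \<longleftrightarrow> (det A \<noteq> 0 \<longrightarrow> (\<forall>f \<in> borel_measurable borel.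
    (\<integral>\<^sup>+y. f y \<partial>lborel) = ennreal \<bar>det A\<bar> * (\<integral>\<^sup>+z. f (A *v z) \<partial>lborel)))" for A :: "real ^ 'n ^ 'n"
  have "P A"
  proof (induction A rule: induct_matrix_elementary)
    case (1 A B)
    show ?case
      unfolding P_def
    proof (intro impI ballI)
      assume "det (A ** B) \<noteq> 0"
      then have det: "det A \<noteq> 0" "det B \<noteq> 0"
        by (simp_all add: det_mul)
      fix f :: "real ^ 'n \<Rightarrow> ennreal"
      assume [measurable]: "f \<in> borel_measurable borel"
      have "(\<integral>\<^sup>+y. f y \<partial>lborel) = ennreal \<bar>det A\<bar> * (\<integral>\<^sup>+z. f (A *v z) \<partial>lborel)"
        by (rule 1(1)[unfolded P_def, rule_format, OF det(1)]) measurable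
      also have "(\<integral>\<^sup>+z. f (A *v z) \<partial>lborel) = ennreal \<bar>det B\<bar> * (\<integral>\<^sup>+z. f (A *v (B *v z)) \<partial>lborel)"
        by (rule 1(2)[unfolded P_def, rule_format, OF det(2)]) measurable
      finally show "(\<integral>\<^sup>+y. f y \<partial>lborel) = ennreal \<bar>det (A ** B)\<bar> * (\<integral>\<^sup>+z. f (A ** B *v z) \<partial>lborel)"
        by (simp add: det_mul abs_mult ennreal_mult matrix_vector_mul_assoc mult.assoc)
    qed
  next
    case (2 A i)
    then show ?case by (simp add: P_def det_zero_row)
  next
    case (3 A)
    show ?case
      unfolding P_def
    proof (intro impI ballI)
      assume "det A \<noteq> 0"
      have det: "det A = (\<Prod>i\<in>UNIV. A $ i $ i)"
        using 3 by (rule det_diagonal)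
      \<comment> \<open>The diagonal entries, indexed by basis vectors as
        \<open>lborel_affine_euclidean\<close> takes them; that fact is used with translation vector
        0.\<close>
      define c where "c b = b \<bullet> (A *v b)" for b
      have c: "c (axis i 1) = A $ i $ i" for i
        by (simp add: c_def matrix_vector_mult_basis inner_axis' column_def)
      have nz: "c b \<noteq> 0" if "b \<in> Basis" for b
        using that \<open>det A \<noteq> 0\<close> by (auto simp: Basis_vec_def c det)
      have abs: "(\<Prod>b\<in>Basis. \<bar>c b\<bar>) = \<bar>det A\<bar>"
        by (simp add: prod_Basis_cart c det abs_prod)
      have T: "0 + (\<Sum>b\<in>Basis. (c b * (z \<bullet> b)) *\<^sub>R b) = A *v z" for z
      proof -
        have "(\<Sum>j\<in>UNIV. A $ i $ j * z $ j) = A $ i $ i * z $ i" for i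
          using 3 by (simp add: sum.remove[of UNIV i])
        then have "A *v z = (\<chi> i. A $ i $ i * z $ i)"
          by (simp add: vec_eq_iff matrix_vector_mult_def)
        moreover have "(\<Sum>b\<in>Basis. (c b * (z \<bullet> b)) *\<^sub>R b) = (\<chi> i. A $ i $ i * z $ i)"
          by (simp only: sum_Basis_cart c cart_eq_inner_axis[symmetric])
            (simp add: vec_eq_iff axis_def if_distrib[of "\<lambda>x. _ * x"] cong: if_cong)
        ultimately show ?thesis
          by simp
      qed
      have D: "lborel = density (distr lborel borel ((*v) A)) (\<lambda>_. ennreal \<bar>det A\<bar>)"
        using lborel_affine_euclidean[of c 0, OF nz] unfolding T abs .
      fix f :: "real ^ 'n \<Rightarrow> ennreal"
      assume [measurable]: "f \<in> borel_measurable borel"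
      show "(\<integral>\<^sup>+y. f y \<partial>lborel) = ennreal \<bar>det A\<bar> * (\<integral>\<^sup>+z. f (A *v z) \<partial>lborel)"
        by (subst D) (simp add: nn_integral_density nn_integral_distr nn_integral_cmult)
    qed
  next
    case (4 m n)
    let ?S = "\<chi> i j. mat 1 $ i $ Transposition.transpose m n j :: real ^ 'n ^ 'n"
    have "\<bar>det ?S\<bar> = 1"
      by (simp add: det_permute_columns permutes_swap_id sign_swap_id abs_mult)
    moreover have "?S *v z = (\<chi> i. z $ Transposition.transpose m n i)" for z
    proof -
      have "mat 1 $ i $ Transposition.transpose m n j * z $ j =
          (if j = Transposition.transpose m n i then z $ j else 0)" for i j
        by (auto simp: mat_def)
      then show ?thesis
        by (simp add: vec_eq_iff matrix_vector_mult_def)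
    qed
    moreover have "(\<lambda>z::real ^ 'n. \<chi> i. z $ Transposition.transpose m n i) \<in> borel \<rightarrow>\<^sub>M borel"
      using borel_measurable_matrix_vector_mult[of ?S] calculation(2) by (simp add: fun_eq_iff cong: measurable_cong)
    ultimately show ?case
      unfolding P_def
      by (subst lborel_distr_transpose[of m n, symmetric]) (simp add: nn_integral_distr)
  next
    case (5 m n c)
    let ?S = "\<chi> i j. if i = m \<and> j = n then c else of_bool (i = j) :: real ^ 'n ^ 'n"
    \<comment> \<open>\<open>?S\<close> arises from the identity by adding \<open>c\<close> times
      row \<open>n\<close> to row \<open>m\<close>, so its determinant is 1; as a map it is a
      shear.\<close>
    have "?S = (\<chi> k. if k = m then row m (mat 1) + c *s row n (mat 1) else row k (mat 1))"
      using 5 by (auto simp: vec_eq_iff row_def mat_def)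
    then have "det ?S = 1"
      using det_row_operation[OF 5, of "mat 1" c] by simp
    moreover have "?S *v z = z + (c * (z \<bullet> axis n 1)) *\<^sub>R axis m 1" for z
      unfolding cart_eq_inner_axis[symmetric]
      using 5 by (auto simp: vec_eq_iff matrix_vector_mult_def axis_def if_distrib[of "\<lambda>x. x * _"]
          sum.remove[of UNIV n] cong: if_cong)
    ultimately show ?case
      unfolding P_def using 5
      by (simp add: nn_integral_lborel_shear axis_eq_axis)
  qed
  then show ?thesis
    using assms unfolding P_def by blast
qed

subsection \<open>The Gaussian measure of a positive definite matrix\<close>

text \<open>Gram-Schmidt for the form given by \<open>G\<close>. Fewer vectors
  \<open>G *v p i\<close> than the dimension cannot span, so some nonzero \<open>w\<close> is
  orthogonal to all of them, that is, \<open>G\<close>-orthogonal to the \<open>p i\<close>.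
  Positivity allows it to be scaled to \<open>G\<close>-length 1.\<close>

lemma positive_definite_orthonormal:
  fixes G :: "real ^ 'n ^ 'n"
  assumes G: "positive_definite G"
  shows "\<exists>p :: 'n \<Rightarrow> real ^ 'n. \<forall>i j. p i \<bullet> (G *v p j) = of_bool (i = j)"
proof -
  have sym: "u \<bullet> (G *v v) = v \<bullet> (G *v u)" for u v
    using G by (metis dot_lmul_matrix inner_commute positive_definite_def transpose_matrix_vector)
  have "\<exists>p :: 'n \<Rightarrow> real ^ 'n. \<forall>i\<in>I. \<forall>j\<in>I. p i \<bullet> (G *v p j) = of_bool (i = j)" if "finite I" for I
    using that
  proof (induction I rule: finite_induct)
    case empty
    then show ?case by simp
  next
    case (insert a I)
    then obtain p :: "'n \<Rightarrow> real ^ 'n" where p: "\<forall>i\<in>I. \<forall>j\<in>I. p i \<bullet> (G *v p j) = of_bool (i = j)"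
      by blast
    let ?S = "(\<lambda>i. G *v p i) ` I"
    have "card I < CARD('n)"
      using insert by (metis UNIV_I finite_class.finite_UNIV psubset_card_mono psubsetI subset_UNIV)
    then have "dim (span ?S) < DIM(real ^ 'n)"
      using dim_le_card'[of ?S] card_image_le[of I "\<lambda>i. G *v p i"] insert by simp
    then have "span ?S \<noteq> UNIV"
      by (metis dim_UNIV nat_less_le)
    then obtain w where w: "w \<noteq> 0" "\<And>x. x \<in> span ?S \<Longrightarrow> w \<bullet> x = 0"
      using span_not_UNIV_orthogonal by blast
    define q where "q = w /\<^sub>R sqrt (w \<bullet> (G *v w))"
    have pos: "w \<bullet> (G *v w) > 0"
      using G w(1) by (simp add: positive_definite_def)
    have "q \<bullet> (G *v q) = 1"
      using pos by (simp add: q_def matrix_vector_mult_scaleR field_simps)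
    moreover have "q \<bullet> (G *v p i) = 0" if "i \<in> I" for i
      using w(2)[of "G *v p i"] that by (simp add: q_def span_base)
    moreover have "p i \<bullet> (G *v q) = 0" if "i \<in> I" for i
      using calculation(2)[OF that] sym by metis
    ultimately have "\<forall>i\<in>insert a I. \<forall>j\<in>insert a I. (p(a := q)) i \<bullet> (G *v (p(a := q)) j) = of_bool (i = j)"
      using p insert.hyps by auto
    then show ?case
      by (rule exI[of _ "p(a := q)"])
  qed
  from this[of UNIV] show ?thesis by simp
qed

text \<open>If the columns of \<open>P\<close> are \<open>G\<close>-orthonormal, then
  \<open>transpose P ** G\<close> is inverse to \<open>P\<close>. Therefore
  \<open>A = G ** P\<close> satisfies
  \<open>A ** transpose A = G ** (P ** (transpose P ** G)) = G\<close>.\<close>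

lemma positive_definite_factor:
  fixes G :: "real ^ 'n ^ 'n"
  assumes G: "positive_definite G"
  obtains A :: "real ^ 'n ^ 'n" where "invertible A" "G = A ** transpose A"
proof -
  obtain p :: "'n \<Rightarrow> real ^ 'n" where p: "\<And>i j. p i \<bullet> (G *v p j) = of_bool (i = j)"
    using positive_definite_orthonormal[OF G] by blast
  define P where "P = (\<chi> i j. p j $ i)"
  have col: "column j P = p j" for j
    by (simp add: P_def column_def vec_eq_iff)
  have "(transpose P ** (G ** P)) $ i $ j = p i \<bullet> (G *v p j)" for i j
    by (simp add: matrix_matrix_mult_def transpose_def P_def inner_vec_def matrix_vector_mult_def)
  then have *: "transpose P ** (G ** P) = mat 1"
    by (simp add: p vec_eq_iff mat_def)
  then have "P ** (transpose P ** G) = mat 1"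
    by (metis matrix_left_right_inverse matrix_mul_assoc)
  moreover have "transpose (G ** P) = transpose P ** G"
    using G by (simp add: matrix_transpose_mul positive_definite_def)
  ultimately have "(G ** P) ** transpose (G ** P) = G"
    by (metis matrix_mul_assoc matrix_mul_rid)
  moreover have "invertible (G ** P)"
    using * invertible_left_inverse by blast
  ultimately show ?thesis
    using that by metis
qed

lemma matrix_inv_left_right:
  assumes "invertible A"
  shows "A ** matrix_inv A = mat 1" "matrix_inv A ** A = mat 1"
  using someI_ex[OF assms[unfolded invertible_def]] by (simp_all add: matrix_inv_def)

text \<open>The vector \<open>w\<close> with \<open>transpose A *v w = z\<close> is the inverse of
  \<open>A ** transpose A\<close> applied to \<open>A *v z\<close>. The form is thus the inner
  product of \<open>A *v z\<close> with \<open>w\<close>, and moving \<open>A\<close> across turns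
  it into \<open>z \<bullet> z\<close>.\<close>

lemma matrix_inv_quadratic_form:
  fixes A :: "real ^ 'n ^ 'n"
  assumes "invertible A"
  shows "(\<Sum>i\<in>UNIV. \<Sum>j\<in>UNIV. matrix_inv (A ** transpose A) $ i $ j * (A *v z) $ i * (A *v z) $ j) = z \<bullet> z"
proof -
  let ?G = "A ** transpose A"
  have T: "invertible (transpose A)"
    using assms by (rule transpose_invertible)
  define w where "w = matrix_inv (transpose A) *v z"
  have w: "transpose A *v w = z"
    using matrix_inv_left_right(1)[OF T] by (simp add: w_def matrix_vector_mul_assoc)
  have Gw: "?G *v w = A *v z"
    by (metis matrix_vector_mul_assoc w)
  have "matrix_inv ?G ** ?G = mat 1"
    using invertible_mult[OF assms T] by (rule matrix_inv_left_right)
  then have "matrix_inv ?G *v (A *v z) = w"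
    by (metis Gw matrix_vector_mul_assoc matrix_vector_mul_lid)
  then have "(A *v z) \<bullet> (matrix_inv ?G *v (A *v z)) = z \<bullet> z"
    by (metis w dot_lmul_matrix inner_commute transpose_matrix_vector)
  then show ?thesis
    by (simp add: inner_vec_def matrix_vector_mult_def[of "matrix_inv ?G"] sum_distrib_left mult_ac)
qed

text \<open>Under y = A z the exponent becomes -(z \<bullet> z)/2 by
  \<open>matrix_inv_quadratic_form\<close>. The Jacobian and the normalisation of the standard
  Gaussian density together make up \<open>c\<close>, because the determinant of
  \<open>A ** transpose A\<close> is the square of \<open>det A\<close>.\<close>

lemma gauss_measure_eq_distr:
  fixes A :: "real ^ 'n ^ 'n"
  assumes A: "invertible A"
  defines "c \<equiv> sqrt ((2 * pi) ^ CARD('n) * det (A ** transpose A))"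
  shows "gauss_measure (A ** transpose A) = density (distr std_gaussian borel ((*v) A)) (\<lambda>_. ennreal c)"
    (is "_ = ?R")
proof (rule measure_eqI)
  show "sets (gauss_measure (A ** transpose A)) = sets ?R"
    by (simp add: gauss_measure_def)
  fix X assume "X \<in> sets (gauss_measure (A ** transpose A))"
  then have X [measurable]: "X \<in> sets borel"
    by (simp add: gauss_measure_def)
  define q where "q = (\<lambda>y :: real ^ 'n. exp (- (1/2) * (\<Sum>i\<in>UNIV. \<Sum>j\<in>UNIV.
    matrix_inv (A ** transpose A) $ i $ j * y $ i * y $ j)))"
  define g where "g = (\<lambda>z :: real ^ 'n. \<Prod>b\<in>Basis. std_normal_density (z \<bullet> b))"
  have gm: "gauss_measure (A ** transpose A) = density lborel (\<lambda>y. ennreal (q y))"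
    by (simp only: gauss_measure_def q_def)
  have sg: "std_gaussian = density lborel (\<lambda>z. ennreal (g z))"
    by (simp only: std_gaussian_def g_def)
  have [measurable]: "q \<in> borel_measurable borel" "g \<in> borel_measurable borel"
    unfolding q_def g_def by measurable
  have det: "det A \<noteq> 0"
    using A by (simp add: invertible_det_nz)
  have c: "c = sqrt (2 * pi) ^ CARD('n) * \<bar>det A\<bar>"
    unfolding c_def by (simp add: det_mul det_transpose real_sqrt_mult real_sqrt_power power_mult_distrib)
  have "q (A *v z) = sqrt (2 * pi) ^ CARD('n) * g z" for z
  proof -
    have "g z = (1 / sqrt (2 * pi)) ^ CARD('n) * (\<Prod>b\<in>Basis. exp (- (z \<bullet> b)\<^sup>2 / 2))"
      by (simp only: g_def std_normal_density_def prod.distrib prod_constant) simp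
    also have "(\<Prod>b\<in>Basis. exp (- (z \<bullet> b)\<^sup>2 / 2)) = exp (- (1 / 2) * (z \<bullet> z))"
      by (simp add: exp_sum[symmetric] euclidean_inner[of z z] power2_eq_square sum_negf sum_divide_distrib)
    also have "\<dots> = q (A *v z)"
      by (simp only: q_def matrix_inv_quadratic_form[OF A])
    finally show ?thesis
      by (simp add: power_divide)
  qed
  then have "\<bar>det A\<bar> * q (A *v z) = c * g z" for z
    by (simp add: c)
  moreover have "0 \<le> c"
    by (simp add: c)
  ultimately have q: "ennreal \<bar>det A\<bar> * ennreal (q (A *v z)) = ennreal c * ennreal (g z)" for z
    by (metis abs_ge_zero ennreal_mult')
  have "emeasure (gauss_measure (A ** transpose A)) X = (\<integral>\<^sup>+y. ennreal (q y) * indicator X y \<partial>lborel)"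
    by (simp add: gm emeasure_density)
  also have "\<dots> = ennreal \<bar>det A\<bar> * (\<integral>\<^sup>+z. ennreal (q (A *v z)) * indicator X (A *v z) \<partial>lborel)"
    by (rule nn_integral_lborel_matrix[OF det]) measurable
  also have "\<dots> = (\<integral>\<^sup>+z. ennreal c * (ennreal (g z) * indicator X (A *v z)) \<partial>lborel)"
    by (simp add: nn_integral_cmult[symmetric] mult.assoc[symmetric] q)
  also have "\<dots> = ennreal c * (\<integral>\<^sup>+z. indicator X (A *v z) \<partial>std_gaussian)"
    by (simp add: nn_integral_cmult sg nn_integral_density)
  also have "(\<integral>\<^sup>+z. indicator X (A *v z) \<partial>std_gaussian) =
      (\<integral>\<^sup>+y. indicator X y \<partial>distr std_gaussian borel ((*v) A))"
    by (subst nn_integral_distr) simp_all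
  also have "ennreal c * \<dots> = emeasure ?R X"
    by (simp add: emeasure_density nn_integral_cmult)
  finally show "emeasure (gauss_measure (A ** transpose A)) X = emeasure ?R X" .
qed

subsection \<open>The induced form\<close>

lemma mpower_eq_prod_index_list:
  "mpower f (Poly_Mapping.lookup m) = prod_list (map f (index_list m))"
proof -
  have "prod_list (map f (concat (map (\<lambda>i. replicate (g i) i) xs))) = (\<Prod>i\<in>set xs. f i ^ g i)"
    if "distinct xs" for g xs
    using that by (induction xs) (auto simp: prod_list_replicate)
  then show ?thesis
    by (simp add: mpower_def index_list_def)
qed

text \<open>One list \<open>ns\<close>, the concatenated index lists of the two monomials, serves
  both sides: its positions index the factors of the integrand and are the points being paired in
  the induced form.\<close>

lemma induced_form_mpower:
  fixes \<alpha> \<beta> :: "'n::{finite,linorder} \<Rightarrow> nat"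
  assumes "mi_length \<alpha> = k" "mi_length \<beta> = k"
  obtains ns where "\<And>f :: 'n \<Rightarrow> real. mpower f \<alpha> * mpower f \<beta> = (\<Prod>i<length ns. f (ns ! i))"
    and "induced_form B x k (mpower Var \<alpha>) (mpower Var \<beta>) =
      pairings (\<lambda>i j. B (x (ns ! i)) (x (ns ! j))) {..<length ns}"
proof -
  obtain m where m: "Poly_Mapping.lookup m = \<alpha>"
    using mpower_Var by blast
  obtain m' where m': "Poly_Mapping.lookup m' = \<beta>"
    using mpower_Var by blast
  let ?ns = "index_list m @ index_list m'"
  have "length (index_list e) = mi_length (Poly_Mapping.lookup e)" for e :: "'n \<Rightarrow>\<^sub>0 nat"
    using sum_count_set[of "index_list e" UNIV] by (simp add: count_index_list mi_length_def)
  then have "length (index_list m) = k" "length (index_list m') = k"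
    using assms m m' by simp_all
  then have "induced_form B x k (mpower Var \<alpha>) (mpower Var \<beta>) = pairing_sum B (map x ?ns)"
    unfolding m[symmetric] m'[symmetric] mpower_eq_prod_index_list
    by (intro induced_form_basis sorted_index_list)
  also have "\<dots> = pairings (\<lambda>i j. B (x (?ns ! i)) (x (?ns ! j))) {..<length ?ns}"
    unfolding pairing_sum_def pairings_def length_map
  proof (intro sum.cong prod.cong refl)
    fix P p assume P: "P \<in> pair_partitions {..<length ?ns}" and p: "p \<in> P"
    have "card p = 2"
      using P p by (simp add: pair_partitions_def)
    then have "finite p" "p \<noteq> {}"
      by (auto intro: card_ge_0_finite)
    then have "Min p \<in> p" "Max p \<in> p"
      by simp_all
    \<comment> \<open>Both are valid positions in the list, so the lookup commutes with
      \<open>map x\<close>.\<close>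
    then have "Min p < length ?ns" "Max p < length ?ns"
      using pair_partitions_subset[OF P p] by blast+
    then show "B (map x ?ns ! Min p) (map x ?ns ! Max p) = B (x (?ns ! Min p)) (x (?ns ! Max p))"
      by (simp only: nth_map)
  qed
  finally have form: "induced_form B x k (mpower Var \<alpha>) (mpower Var \<beta>) =
    pairings (\<lambda>i j. B (x (?ns ! i)) (x (?ns ! j))) {..<length ?ns}" .
  have nth: "prod_list (map f ns) = (\<Prod>i<length ns. f (ns ! i))" for f :: "'n \<Rightarrow> real" and ns
    by (simp add: prod.list_conv_set_nth atLeast0LessThan)
  have "mpower f \<alpha> * mpower f \<beta> = (\<Prod>i<length ?ns. f (?ns ! i))" for f :: "'n \<Rightarrow> real"
    unfolding nth[symmetric] by (simp add: m[symmetric] m'[symmetric] mpower_eq_prod_index_list)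
  then show ?thesis
    using that form by blast
qed

theorem proposition3p5:
  fixes x :: "'n::{finite,linorder} \<Rightarrow> 'v::real_vector"
    and B :: "'v \<Rightarrow> 'v \<Rightarrow> real"
    and d k :: nat
  assumes "CARD('n) = d + 1"
    and "inj x" and "independent (range x)" and "span (range x) = UNIV"
    and "bilinear B" and "\<And>u v. B u v = B v u"
    and "positive_definite (gram B x)"
  shows "gauss_const (gram B x) = sqrt ((2 * pi) ^ (d + 1) * det (gram B x)) \<and>
    (\<forall>\<alpha> \<beta> :: 'n \<Rightarrow> nat. mi_length \<alpha> = k \<longrightarrow> mi_length \<beta> = k \<longrightarrow>
      integrable (gauss_measure (gram B x)) (\<lambda>y. mpower (($) y) \<alpha> * mpower (($) y) \<beta>) \<and>
      induced_form B x k (mpower Var \<alpha>) (mpower Var \<beta>) =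
        1 / gauss_const (gram B x) *
        (\<integral>y. mpower (($) y) \<alpha> * mpower (($) y) \<beta> \<partial>gauss_measure (gram B x)))"
proof -
  let ?G = "gram B x"
  obtain A :: "((real, 'n) vec, 'n) vec" where A: "invertible A" "?G = A ** transpose A"
    using assms(7) by (rule positive_definite_factor)
  define c where "c = sqrt ((2 * pi) ^ (d + 1) * det ?G)"
  have det: "det A \<noteq> 0"
    using A(1) by (simp add: invertible_det_nz)
  then have c: "c > 0"
    by (simp add: c_def A(2) det_mul det_transpose zero_less_mult_iff linorder_neq_iff disj_commute)
  have gauss: "gauss_measure ?G = density (distr std_gaussian borel ((*v) A)) (\<lambda>_. ennreal c)"
    using gauss_measure_eq_distr[OF A(1)] by (simp only: A(2) c_def assms(1))
  have integral: "(\<integral>y. f y \<partial>gauss_measure ?G) = c * (\<integral>z. f (A *v z) \<partial>std_gaussian)"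
    if [measurable]: "f \<in> borel_measurable borel" for f :: "(real, 'n) vec \<Rightarrow> real"
    unfolding gauss using c by (simp add: integral_density integral_distr)
  have integrable: "integrable (gauss_measure ?G) f \<longleftrightarrow> integrable std_gaussian (\<lambda>z. f (A *v z))"
    if [measurable]: "f \<in> borel_measurable borel" for f :: "(real, 'n) vec \<Rightarrow> real"
    unfolding gauss using c by (simp add: integrable_density integrable_distr_eq)
  \<comment> \<open>Wick's formula for no factors: the standard Gaussian measure has total mass 1,
    which identifies the normalising constant as \<open>c\<close>.\<close>
  have "(\<integral>z. (1::real) \<partial>(std_gaussian :: ((real, 'n) vec) measure)) = 1"
    using std_gaussian_wick[of "{}" "\<lambda>_. 0 :: (real, 'n) vec"] by (simp add: pairings_empty)
  then have const: "gauss_const ?G = c"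
    unfolding gauss_const_def by (subst integral) simp_all
  have "integrable (gauss_measure ?G) (\<lambda>y. mpower (($) y) \<alpha> * mpower (($) y) \<beta>) \<and>
      induced_form B x k (mpower Var \<alpha>) (mpower Var \<beta>) =
        1 / c * (\<integral>y. mpower (($) y) \<alpha> * mpower (($) y) \<beta> \<partial>gauss_measure ?G)"
    if \<alpha>: "mi_length \<alpha> = k" and \<beta>: "mi_length \<beta> = k" for \<alpha> \<beta> :: "'n \<Rightarrow> nat"
  proof -
    obtain ns where ns: "\<And>f :: 'n \<Rightarrow> real. mpower f \<alpha> * mpower f \<beta> = (\<Prod>i<length ns. f (ns ! i))"
      and form: "induced_form B x k (mpower Var \<alpha>) (mpower Var \<beta>) =
        pairings (\<lambda>i j. B (x (ns ! i)) (x (ns ! j))) {..<length ns}"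
      using induced_form_mpower[OF \<alpha> \<beta>] by metis
    have meas: "(\<lambda>y :: (real, 'n) vec. \<Prod>i<length ns. y $ (ns ! i)) \<in> borel_measurable borel"
      by measurable
    have row: "(A *v z) $ n = z \<bullet> A $ n" for z n
      by (simp add: matrix_vector_mult_def inner_vec_def mult.commute)
    \<comment> \<open>The coordinates of \<open>A *v z\<close> are the linear forms given by the
      rows of \<open>A\<close>, and these rows have Gram matrix \<open>?G\<close>. So the pairings
      in Wick's formula are those of the induced form.\<close>
    have "B (x m) (x n) = A $ m \<bullet> A $ n" for m n
    proof -
      have "B (x m) (x n) = (A ** transpose A) $ m $ n"
        by (simp add: A(2)[symmetric] gram_def)
      then show ?thesis
        by (simp add: matrix_matrix_mult_def transpose_def inner_vec_def)
    qed
    then show ?thesis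
      using c unfolding ns form integrable[OF meas] integral[OF meas]
      by (simp add: row integrable_prod_inner std_gaussian_wick)
  qed
  then show ?thesis
    by (simp add: const c_def)
qed

end
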